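(* Let $m,n,I_1,\dots,I_m$ be positive integers. Let $f:\mathbb{R}^n\to\mathbb{R}^n$ be continuous and suppose there exists a constant $\alpha$ such that $(x-y)^{\top}[f(x)-f(y)]\le \alpha (x-y)^{\top}(x-y)$ for all $x,y\in\mathbb{R}^n$. For each $k=1,\dots,m$ let $c_k$ be a constant (the coupling strength of the $k$th order subnetwork) and let $L^{(k)}=[l^{(k)}_{ij}]\in\mathbb{R}^{I_k\times I_k}$ be a symmetric matrix with $l^{(k)}_{ij}\ge 0$ for $i\ne j$ and all row sums equal to zero, with eigenvalues $0=\lambda^{(k)}_1\ge\lambda^{(k)}_2\ge\cdots\ge\lambda^{(k)}_{I_k}$. Consider the $m$th order layered network $$\frac{d x_{i_1,\dots,i_m}(t)}{dt}=f(x_{i_1,\dots,i_m}(t))+\sum_{k=1}^{m}c_k\sum_{j=1}^{I_k}l^{(k)}_{i_k j}\,x_{i_1,\dots,i_{k-1},j,i_{k+1},\dots,i_m}(t),\qquad 1\le i_s\le I_s,\ s=1,\dots,m,$$ with $x_{i_1,\dots,i_m}(t)\in\mathbb{R}^n$. Then for any $k=1,\dots,m$, the network can reach $k$th order synchronization if $c_k\lambda^{(k)}_2+\alpha<0$.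
   Context: Definition. For $1\le k\le m$, the network is said to reach $k$th order synchronization if for any $1\le p,q\le I_k$, $$\lim_{t\to\infty}\|x_{i_1,\dots,i_{k-1},p,i_{k+1},\dots,i_m}(t)-x_{i_1,\dots,i_{k-1},q,i_{k+1},\dots,i_m}(t)\|=0$$ holds for any fixed $i_s=1,\dots,I_s$, $s\in\{1,\dots,m\}\setminus\{k\}$.
   Formalization: The coupling strengths c_1,…,c_m are assumed nonnegative; for negative ones the claim fails, e.g. m=n=1, the path on 3 nodes (eigenvalues 0,-1,-3), f(x)=-2x, α=-2, c=-1, where c·λ_2+α=-1<0 but a mode grows like e^t. *)

theory Defs
  imports "HOL-Analysis.Analysis" "Jordan_Normal_Form.Char_Poly"
begin

text \<open>
  Orders are numbered \<open>1, \<dots>, m\<close>; the indices within the subnetwork of order \<open>s\<close> are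
  \<open>0, \<dots>, I s - 1\<close>, matching the zero-based entries of \<open>mat\<close>. A node
  \<open>(i\<^sub>1, \<dots>, i\<^sub>m)\<close> is a function \<open>i\<close> in \<open>nodes m I\<close>, and replacing its
  \<open>k\<close>-th index by \<open>j\<close> is \<open>i(k := j)\<close>.
\<close>

definition nodes :: "nat \<Rightarrow> (nat \<Rightarrow> nat) \<Rightarrow> (nat \<Rightarrow> nat) set" where
  "nodes m I = (\<Pi>\<^sub>E s\<in>{1..m}. {..<I s})"

definition coupling_matrix :: "nat \<Rightarrow> real mat \<Rightarrow> bool" where
  "coupling_matrix N A \<longleftrightarrow>
     A \<in> carrier_mat N N \<and>
     transpose_mat A = A \<and>
     (\<forall>i<N. \<forall>j<N. i \<noteq> j \<longrightarrow> A $$ (i, j) \<ge> 0) \<and>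
     (\<forall>i<N. (\<Sum>j<N. A $$ (i, j)) = 0)"

text \<open>
  \<open>lam 1 \<ge> lam 2 \<ge> \<dots> \<ge> lam N\<close> are the eigenvalues of \<open>A\<close>, repeated
  according to multiplicity. Only the values of \<open>lam\<close> on \<open>{1..N}\<close> are constrained.
\<close>

definition ordered_eigenvalues :: "nat \<Rightarrow> real mat \<Rightarrow> (nat \<Rightarrow> real) \<Rightarrow> bool" where
  "ordered_eigenvalues N A lam \<longleftrightarrow>
     char_poly A = (\<Prod>j\<in>{1..N}. [:- lam j, 1:]) \<and>
     antimono_on {1..N} lam"

definition network_solution ::
  "nat \<Rightarrow> (nat \<Rightarrow> nat) \<Rightarrow> (real^'n \<Rightarrow> real^'n) \<Rightarrow> (nat \<Rightarrow> real) \<Rightarrow> (nat \<Rightarrow> real mat) \<Rightarrow>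
   ((nat \<Rightarrow> nat) \<Rightarrow> real \<Rightarrow> real^'n) \<Rightarrow> bool" where
  "network_solution m I f c L x \<longleftrightarrow>
     (\<forall>i\<in>nodes m I. \<forall>t\<ge>0.
        (x i has_vector_derivative
           (f (x i t) +
            (\<Sum>k=1..m. c k *\<^sub>R (\<Sum>j<I k. (L k $$ (i k, j)) *\<^sub>R x (i(k := j)) t))))
        (at t within {0..}))"

text \<open>
  In the next definition \<open>i k\<close> is overwritten, so \<open>i\<close> only fixes the indices
  of orders other than \<open>k\<close>.
\<close>

definition synchronized_of_order ::
  "nat \<Rightarrow> (nat \<Rightarrow> nat) \<Rightarrow> nat \<Rightarrow> ((nat \<Rightarrow> nat) \<Rightarrow> real \<Rightarrow> real^'n) \<Rightarrow> bool" where
  "synchronized_of_order m I k x \<longleftrightarrow>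
     (\<forall>p<I k. \<forall>q<I k. \<forall>i\<in>nodes m I.
        ((\<lambda>t. norm (x (i(k := p)) t - x (i(k := q)) t)) \<longlongrightarrow> 0) at_top)"

definition network_reaches_synchronization ::
  "nat \<Rightarrow> (nat \<Rightarrow> nat) \<Rightarrow> (real^'n \<Rightarrow> real^'n) \<Rightarrow> (nat \<Rightarrow> real) \<Rightarrow> (nat \<Rightarrow> real mat) \<Rightarrow>
   nat \<Rightarrow> bool" where
  "network_reaches_synchronization m I f c L k \<longleftrightarrow>
     (\<forall>x. network_solution m I f c L x \<longrightarrow> synchronized_of_order m I k x)"

end

theory Submission
  imports Defs "Jordan_Normal_Form.Schur_Decomposition"
begin

text \<open>
  Let \<open>e\<^sub>i\<close> be the deviation of \<open>x\<^sub>i\<close> from the mean of \<open>x\<close> over the \<open>k\<close>-th index, and let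
  \<open>V\<close> be the sum of the \<open>|e\<^sub>i|\<^sup>2\<close> over all nodes. Since the deviations sum to zero along
  every \<open>k\<close>-fibre, terms independent of the \<open>k\<close>-th index may be added to the vector field without
  changing \<open>V'\<close>. Hence \<open>f\<close> contributes at most \<open>2 \<alpha> V\<close>, and in the coupling terms \<open>x\<close> may be
  replaced by \<open>e\<close>. The coupling of an order other than \<open>k\<close> then contributes a nonpositive
  amount, and that of order \<open>k\<close> at most \<open>2 c\<^sub>k lam\<^sub>2 V\<close>, because \<open>e\<close> is orthogonal to the
  constants on each \<open>k\<close>-fibre. So \<open>V\<close> decays exponentially. The spectral bound comes from
  maximizing the Rayleigh quotient on the sum-zero vectors: the maximizer is an eigenvector other
  than the constant one.
\<close>

unbundle no vec_syntax

section \<open>Coupling matrices as negative semidefinite forms\<close>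

lemma ordered_eigenvalues_nonpos:
  assumes "ordered_eigenvalues N A lam" "lam 1 = 0" "N \<ge> 2"
  shows "lam 2 \<le> 0"
proof -
  have "antimono_on {1..N} lam" using assms(1) by (simp add: ordered_eigenvalues_def)
  from monotone_onD[OF this, of 1 2] show ?thesis using assms by simp
qed

lemma coupling_matrix_sym:
  assumes "coupling_matrix N A" "i < N" "j < N"
  shows "A $$ (i, j) = A $$ (j, i)"
  using assms index_transpose_mat(1)[of j A i] by (auto simp: coupling_matrix_def)

text \<open>Symmetry and zero row sums turn the form into minus one half of the sum of
  \<open>A $$ (p, j) * |y p - y j|^2\<close>. The diagonal terms vanish there, and the remaining
  weights are nonnegative.\<close>

lemma coupling_matrix_form_nonpos:
  fixes y :: "nat \<Rightarrow> 'v::real_inner"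
  assumes "coupling_matrix N A"
  shows "(\<Sum>p<N. inner (y p) (\<Sum>j<N. A $$ (p, j) *\<^sub>R y j)) \<le> 0"
proof -
  have nn: "\<And>i j. i < N \<Longrightarrow> j < N \<Longrightarrow> i \<noteq> j \<Longrightarrow> A $$ (i, j) \<ge> 0"
    and rs: "\<And>i. i < N \<Longrightarrow> (\<Sum>j<N. A $$ (i, j)) = 0"
    using assms by (auto simp: coupling_matrix_def)
  note sym = coupling_matrix_sym[OF assms]
  have "0 \<le> (\<Sum>p<N. \<Sum>j<N. A $$ (p, j) * inner (y p - y j) (y p - y j))"
  proof (intro sum_nonneg)
    fix p j assume "p \<in> {..<N}" "j \<in> {..<N}"
    then show "0 \<le> A $$ (p, j) * inner (y p - y j) (y p - y j)"
      using nn[of p j] by (cases "p = j") auto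
  qed
  also have "\<dots> = (\<Sum>p<N. \<Sum>j<N. A $$ (p, j) * inner (y p) (y p))
      + (\<Sum>p<N. \<Sum>j<N. A $$ (p, j) * inner (y j) (y j))
      - 2 * (\<Sum>p<N. \<Sum>j<N. A $$ (p, j) * inner (y p) (y j))"
    by (simp add: inner_diff_left inner_diff_right algebra_simps sum.distrib sum_subtractf
        sum_distrib_left inner_commute)
  also have "(\<Sum>p<N. \<Sum>j<N. A $$ (p, j) * inner (y p) (y p)) = 0"
    by (simp add: sum_distrib_right[symmetric] rs)
  also have "(\<Sum>p<N. \<Sum>j<N. A $$ (p, j) * inner (y j) (y j))
      = (\<Sum>j<N. (\<Sum>p<N. A $$ (j, p)) * inner (y j) (y j))"
    by (subst sum.swap) (auto simp: sum_distrib_right sym intro!: sum.cong)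
  also have "\<dots> = 0" by (simp add: rs)
  finally show ?thesis by (simp add: inner_sum_right)
qed

section \<open>The Rayleigh quotient on sum-zero vectors\<close>

text \<open>Vectors of length \<open>N\<close> are encoded as functions vanishing from
  \<open>N\<close> on. This makes the sum-zero unit sphere a compact set of functions, on which a
  continuous \<open>Q\<close> attains its supremum.\<close>

lemma exists_rayleigh_maximizer:
  fixes Q :: "(nat \<Rightarrow> real) \<Rightarrow> real"
  assumes cont: "continuous_on UNIV Q" and "N \<ge> 2"
  obtains w where "(\<Sum>i<N. w i) = 0" "(\<Sum>i<N. (w i)\<^sup>2) = 1" "\<And>i. i \<ge> N \<Longrightarrow> w i = 0"
    "\<And>v. (\<Sum>i<N. v i) = 0 \<Longrightarrow> (\<Sum>i<N. (v i)\<^sup>2) = 1 \<Longrightarrow> (\<And>i. i \<ge> N \<Longrightarrow> v i = 0) \<Longrightarrow> Q v \<le> Q w"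
proof -
  define C where "C = (\<Pi>\<^sub>E i\<in>(UNIV::nat set). if i < N then {-1..1::real} else {0})"
  define K where "K = C \<inter> {v. (\<Sum>i<N. v i) = 0} \<inter> {v. (\<Sum>i<N. (v i)\<^sup>2) = 1}"
  have "compact C"
  proof -
    \<comment> \<open>Tychonoff in the product topology on \<open>nat \<Rightarrow> real\<close>, since no type has dimension \<open>N\<close>\<close>
    have "compactin (product_topology (\<lambda>_::nat. euclidean) UNIV) C"
      unfolding C_def compactin_PiE by auto
    then show ?thesis by (simp add: euclidean_product_topology)
  qed
  moreover have "closed {v::nat \<Rightarrow> real. (\<Sum>i<N. v i) = 0}" "closed {v::nat \<Rightarrow> real. (\<Sum>i<N. (v i)\<^sup>2) = 1}"
    by (auto intro!: closed_Collect_eq continuous_intros)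
  ultimately have "compact K" unfolding K_def by (intro compact_Int_closed)
  moreover have "K \<noteq> {}"
  proof -
    \<comment> \<open>The normalized difference of the first two unit vectors;
      \<open>N \<ge> 2\<close> makes room for it.\<close>
    define v :: "nat \<Rightarrow> real" where "v i = (if i = 0 then 1 / sqrt 2 else if i = 1 then - 1 / sqrt 2 else 0)" for i
    have sp: "{..<N} = {0, 1} \<union> {2..<N}" using \<open>N \<ge> 2\<close> by auto
    have "(\<Sum>i<N. v i) = 0" "(\<Sum>i<N. (v i)\<^sup>2) = 1"
      unfolding sp by (subst sum.union_disjoint; auto simp: v_def power_divide)+
    moreover have "- 1 \<le> 1 / sqrt 2" by (rule order_trans[of _ 0]) auto
    then have "v \<in> C" using \<open>N \<ge> 2\<close> by (auto simp: C_def v_def PiE_iff)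
    ultimately show ?thesis by (auto simp: K_def)
  qed
  moreover have "continuous_on K Q" using cont continuous_on_subset by blast
  ultimately obtain w where w: "w \<in> K" "\<And>v. v \<in> K \<Longrightarrow> Q v \<le> Q w"
    using continuous_attains_sup[of K Q] by blast
  show thesis
  proof (rule that[of w])
    show "(\<Sum>i<N. w i) = 0" "(\<Sum>i<N. (w i)\<^sup>2) = 1" using w(1) by (auto simp: K_def)
    show "w i = 0" if "i \<ge> N" for i
      using w(1) that by (auto simp: K_def C_def PiE_iff dest!: spec[of _ i])
    fix v :: "nat \<Rightarrow> real" assume v: "(\<Sum>i<N. v i) = 0" "(\<Sum>i<N. (v i)\<^sup>2) = 1" "\<And>i. i \<ge> N \<Longrightarrow> v i = 0"
    \<comment> \<open>A unit vector has coordinates of modulus at most 1, so the box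
      \<open>C\<close> excludes no competitor.\<close>
    have "v i \<in> {-1..1}" if "i < N" for i
    proof -
      have "(v i)\<^sup>2 \<le> (\<Sum>i<N. (v i)\<^sup>2)" using that by (intro member_le_sum) auto
      then have "\<bar>v i\<bar> \<le> 1" using v(2) by (simp add: abs_square_le_1)
      then show ?thesis by auto
    qed
    then have "v \<in> K" using v by (auto simp: K_def C_def PiE_iff not_less)
    then show "Q v \<le> Q w" by (rule w(2))
  qed
qed

text \<open>If \<open>b\<close> were nonzero, the quadratic would be negative at
  \<open>e = - b\<close> when \<open>a \<le> 0\<close>, and at its minimizer
  \<open>e = - b / a\<close>, with value \<open>- b * b / a\<close>, when
  \<open>a > 0\<close>.\<close>

lemma nonneg_quadratic_linear_coeff_zero:
  fixes a b :: real
  assumes "\<And>e. 0 \<le> 2 * e * b + e\<^sup>2 * a"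
  shows "b = 0"
proof (rule ccontr)
  assume "b \<noteq> 0"
  show False
  proof (cases "a \<le> 0")
    case True
    have "0 \<le> 2 * (- b) * b + (- b)\<^sup>2 * a" by (rule assms)
    moreover have "(- b)\<^sup>2 * a \<le> 0" using True by (simp add: mult_nonneg_nonpos)
    moreover have "b * b > 0" using \<open>b \<noteq> 0\<close> by (simp add: zero_less_mult_iff) linarith
    ultimately show False by linarith
  next
    case False
    have "0 \<le> 2 * (- b / a) * b + (- b / a)\<^sup>2 * a" by (rule assms)
    also have "\<dots> = - (b * b / a)" using False by (simp add: field_simps power2_eq_square)
    finally show False using False \<open>b \<noteq> 0\<close> by (simp add: divide_le_0_iff) (smt (verit) mult_pos_pos mult_neg_neg)
  qed
qed

text \<open>The first variation at the maximizer vanishes in all sum-zero directions. The residual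
  of the eigenvalue equation is itself such a direction, because the column sums of \<open>a\<close>
  are zero; hence it is orthogonal to itself and vanishes. No multiplier for the sum constraint
  remains.\<close>

lemma rayleigh_eigenvector:
  fixes a :: "nat \<Rightarrow> nat \<Rightarrow> real"
  assumes sym: "\<And>i j. i < N \<Longrightarrow> j < N \<Longrightarrow> a i j = a j i"
    and rs: "\<And>i. i < N \<Longrightarrow> (\<Sum>j<N. a i j) = 0" and "N \<ge> 2"
  obtains \<mu> w where "(\<Sum>i<N. w i) = 0" "(\<Sum>i<N. (w i)\<^sup>2) = 1"
    "\<forall>i<N. (\<Sum>j<N. a i j * w j) = \<mu> * w i"
    "\<forall>v. (\<Sum>i<N. v i) = 0 \<longrightarrow> (\<Sum>i<N. v i * (\<Sum>j<N. a i j * v j)) \<le> \<mu> * (\<Sum>i<N. (v i)\<^sup>2)"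
proof -
  define Q where "Q v = (\<Sum>i<N. v i * (\<Sum>j<N. a i j * v j))" for v :: "nat \<Rightarrow> real"
  have "continuous_on UNIV Q" unfolding Q_def by (intro continuous_intros continuous_on_product_coordinates)
  from exists_rayleigh_maximizer[OF this \<open>N \<ge> 2\<close>] obtain w where w:
    "(\<Sum>i<N. w i) = 0" "(\<Sum>i<N. (w i)\<^sup>2) = 1" 
    and max: "\<And>v. (\<Sum>i<N. v i) = 0 \<Longrightarrow> (\<Sum>i<N. (v i)\<^sup>2) = 1 \<Longrightarrow> (\<And>i. i \<ge> N \<Longrightarrow> v i = 0) \<Longrightarrow> Q v \<le> Q w"
    by metis
  define \<mu> where "\<mu> = Q w"
  have bound: "Q v \<le> \<mu> * (\<Sum>i<N. (v i)\<^sup>2)" if v: "(\<Sum>i<N. v i) = 0" for v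
  proof (cases "(\<Sum>i<N. (v i)\<^sup>2) = 0")
    case True
    then have "\<forall>i<N. v i = 0" by (subst (asm) sum_nonneg_eq_0_iff) auto
    then show ?thesis by (simp add: Q_def)
  next
    case False
    define r where "r = sqrt (\<Sum>i<N. (v i)\<^sup>2)"
    have r2: "r\<^sup>2 = (\<Sum>i<N. (v i)\<^sup>2)" by (simp add: r_def sum_nonneg)
    then have r0: "r \<noteq> 0" using False by auto
    define u where "u i = (if i < N then v i / r else 0)" for i
    have "(\<Sum>i<N. u i) = (\<Sum>i<N. v i) / r" "(\<Sum>i<N. (u i)\<^sup>2) = (\<Sum>i<N. (v i)\<^sup>2) / r\<^sup>2"
      by (simp_all add: u_def sum_divide_distrib power_divide)
    then have "Q u \<le> \<mu>" using v r2 r0 unfolding \<mu>_def by (intro max) (auto simp: u_def)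
    moreover have "Q u = Q v / r\<^sup>2"
      by (simp add: Q_def u_def sum_divide_distrib sum_distrib_left power2_eq_square)
    ultimately show ?thesis using r0 by (simp add: field_simps flip: r2)
  qed
  \<comment> \<open>\<open>g u\<close> is the residual \<open>\<mu> u - a u\<close>, and
    \<open>B\<close> is the symmetric bilinear form it defines; \<open>B v v\<close> is the slack in
    \<open>bound\<close>.\<close>
  define g where "g u i = \<mu> * u i - (\<Sum>j<N. a i j * u j)" for u :: "nat \<Rightarrow> real" and i
  define B where "B u v = (\<Sum>i<N. g u i * v i)" for u v :: "nat \<Rightarrow> real"
  have Bvv: "B v v = \<mu> * (\<Sum>i<N. (v i)\<^sup>2) - Q v" for v
    by (simp add: B_def g_def Q_def sum_distrib_left sum_subtractf[symmetric] algebra_simps power2_eq_square)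
  have Bsym: "B u v = B v u" for u v
  proof -
    have "(\<Sum>i<N. (\<Sum>j<N. a i j * u j) * v i) = (\<Sum>i<N. (\<Sum>j<N. a i j * v j) * u i)"
      unfolding sum_distrib_right by (subst sum.swap) (auto intro!: sum.cong simp: sym)
    then show ?thesis
      by (simp add: B_def g_def algebra_simps sum_subtractf)
  qed
  have Badd: "B (\<lambda>i. u i + e * v i) (\<lambda>i. u i + e * v i) = B u u + 2 * e * B u v + e\<^sup>2 * B v v" for u v e
  proof -
    have glin: "g (\<lambda>i. u i + e * v i) i = g u i + e * g v i" for i
      by (simp add: g_def algebra_simps sum.distrib sum_distrib_left)
    have "B (\<lambda>i. u i + e * v i) (\<lambda>i. u i + e * v i) = B u u + e * B u v + e * B v u + e\<^sup>2 * B v v"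
      by (simp add: B_def glin algebra_simps sum.distrib sum_distrib_left power2_eq_square)
    then show ?thesis by (simp add: Bsym[of v u])
  qed
  \<comment> \<open>\<open>B\<close> is positive semidefinite on the sum-zero vectors and \<open>B w w = 0\<close>\<close>
  have B0: "B w v = 0" if v: "(\<Sum>i<N. v i) = 0" for v
  proof (rule nonneg_quadratic_linear_coeff_zero[of _ "B v v"])
    fix e
    have "(\<Sum>i<N. w i + e * v i) = 0" using v w by (simp add: sum.distrib sum_distrib_left[symmetric])
    from bound[OF this] have "0 \<le> B (\<lambda>i. w i + e * v i) (\<lambda>i. w i + e * v i)" by (simp add: Bvv)
    also have "\<dots> = 2 * e * B w v + e\<^sup>2 * B v v"
      unfolding Badd using w by (simp add: Bvv \<mu>_def)
    finally show "0 \<le> 2 * e * B w v + e\<^sup>2 * B v v" .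
  qed
  have "(\<Sum>i<N. \<Sum>j<N. a i j * w j) = (\<Sum>j<N. (\<Sum>i<N. a j i) * w j)"
    unfolding sum_distrib_right by (subst sum.swap) (auto intro!: sum.cong simp: sym)
  then have "(\<Sum>i<N. g w i) = 0"
    using w by (simp add: g_def sum_subtractf rs sum_distrib_left[symmetric])
  \<comment> \<open>The direction chosen is \<open>v = g w\<close>, which turns \<open>B w v\<close>
    into a sum of squares.\<close>
  from B0[OF this] have "\<forall>i<N. g w i = 0"
    unfolding B_def by (subst (asm) sum_nonneg_eq_0_iff) auto
  then show thesis using w bound unfolding g_def Q_def by (intro that[of w \<mu>]) auto
qed

section \<open>The kernel when zero is a simple eigenvalue\<close>

text \<open>Back substitution from the last row upwards: in row \<open>i\<close> the entries left of
  the diagonal are zero, and those to its right meet coordinates already shown to vanish. Row 0 is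
  left out since its diagonal entry may be zero.\<close>

lemma upper_triangular_kernel:
  fixes B :: "'a::idom mat"
  assumes B: "B \<in> carrier_mat n n" and ut: "upper_triangular B"
    and d: "\<And>i. 1 \<le> i \<Longrightarrow> i < n \<Longrightarrow> B $$ (i, i) \<noteq> 0"
    and y: "y \<in> carrier_vec n" and ker: "B *\<^sub>v y = 0\<^sub>v n"
    and "1 \<le> i" "i < n"
  shows "y $ i = 0"
  using \<open>1 \<le> i\<close> \<open>i < n\<close>
proof (induction "n - i" arbitrary: i rule: less_induct)
  case less
  have "0 = (B *\<^sub>v y) $ i" using ker less.prems by simp
  also have "\<dots> = (\<Sum>j<n. B $$ (i, j) * y $ j)"
    using B y less.prems by (simp add: scalar_prod_def lessThan_atLeast0)
  also have "\<dots> = (\<Sum>j<n. if j = i then B $$ (i, i) * y $ i else 0)"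
  proof (intro sum.cong refl)
    fix j assume j: "j \<in> {..<n}"
    consider "j < i" | "j = i" | "j > i" by linarith
    then show "B $$ (i, j) * y $ j = (if j = i then B $$ (i, i) * y $ i else 0)"
    proof cases
      case 1
      then show ?thesis using ut B less.prems by (auto dest: upper_triangularD)
    next
      case 3
      then show ?thesis using less.hyps[of j] less.prems j by auto
    qed auto
  qed
  also have "\<dots> = B $$ (i, i) * y $ i" using less.prems by simp
  finally show ?case using d less.prems by simp
qed

text \<open>A Schur form with the eigenvalue 0 in the top left corner has nonzero diagonal entries
  below. In Schur coordinates a kernel vector is therefore supported on coordinate 0, so any two of
  them are proportional once one is nonzero.\<close>

lemma kernel_unique_of_simple_zero:
  fixes A :: "real mat"
  assumes A: "A \<in> carrier_mat n n" and cp: "char_poly A = (\<Prod>e\<leftarrow>0 # es. [:- e, 1:])"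
    and es: "0 \<notin> set es"
    and a: "a \<in> carrier_vec n" "A *\<^sub>v a = 0\<^sub>v n" "a \<noteq> 0\<^sub>v n"
    and w: "w \<in> carrier_vec n" "A *\<^sub>v w = 0\<^sub>v n"
  shows "\<exists>c. w = c \<cdot>\<^sub>v a"
proof -
  obtain B P Q where sd: "schur_decomposition A (0 # es) = (B, P, Q)"
    by (metis prod_cases3)
  from schur_decomposition[OF A cp sd] have wit: "similar_mat_wit A B P Q"
    and ut: "upper_triangular B" and dg: "diag_mat B = 0 # es" by auto
  note W = similar_mat_witD2[OF A wit]
  have Bn: "B $$ (i, i) \<noteq> 0" if "1 \<le> i" "i < n" for i
  proof -
    have "B $$ (i, i) = diag_mat B ! i" using that W(5) by (simp add: diag_mat_def)
    also have "\<dots> = es ! (i - 1)" using that dg by (simp add: nth_Cons')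
    also have "\<dots> \<in> set es"
    proof (rule nth_mem)
      have "length (diag_mat B) = n" using W(5) by (simp add: diag_mat_def)
      then show "i - 1 < length es" using dg that by simp
    qed
    finally show ?thesis using es by auto
  qed
  \<comment> \<open>\<open>A = P * B * Q\<close> and \<open>Q * P = 1\<close> give
    \<open>B (Q v) = Q (A v)\<close>, so \<open>Q\<close> maps the kernel of \<open>A\<close> into
    that of \<open>B\<close>.\<close>
  have ker: "(Q *\<^sub>v v) $ i = 0" if v: "v \<in> carrier_vec n" "A *\<^sub>v v = 0\<^sub>v n" "1 \<le> i" "i < n" for v i
  proof (rule upper_triangular_kernel[OF W(5) ut Bn _ _ \<open>1 \<le> i\<close> \<open>i < n\<close>])
    show "Q *\<^sub>v v \<in> carrier_vec n" using W v by simp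
    have "B *\<^sub>v (Q *\<^sub>v v) = 1\<^sub>m n *\<^sub>v (B *\<^sub>v (Q *\<^sub>v v))" using W v by simp
    also have "\<dots> = (Q * P) *\<^sub>v (B *\<^sub>v (Q *\<^sub>v v))" using W by simp
    also have "\<dots> = Q *\<^sub>v (A *\<^sub>v v)"
      unfolding W(3) using W(5-7) v(1) by (simp add: assoc_mult_mat_vec[of _ n n _ n])
    also have "\<dots> = 0\<^sub>v n" using W v by auto
    finally show "B *\<^sub>v (Q *\<^sub>v v) = 0\<^sub>v n" .
  qed auto
  have PQ: "P *\<^sub>v (Q *\<^sub>v v) = v" if "v \<in> carrier_vec n" for v
    using W that by (simp flip: assoc_mult_mat_vec[of _ n n _ n])
  have Qa: "(Q *\<^sub>v a) $ 0 \<noteq> 0"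
  proof
    assume "(Q *\<^sub>v a) $ 0 = 0"
    then have "(Q *\<^sub>v a) $ i = 0" if "i < n" for i using ker[OF a(1,2), of i] that by (cases i) auto
    then have "Q *\<^sub>v a = 0\<^sub>v n" using W by (intro eq_vecI) auto
    then have "a = P *\<^sub>v 0\<^sub>v n" using PQ[OF a(1)] by simp
    then show False using a(3) W by auto
  qed
  define c where "c = (Q *\<^sub>v w) $ 0 / (Q *\<^sub>v a) $ 0"
  have "Q *\<^sub>v w = c \<cdot>\<^sub>v (Q *\<^sub>v a)"
  proof (rule eq_vecI)
    fix i assume "i < dim_vec (c \<cdot>\<^sub>v (Q *\<^sub>v a))"
    then have i: "i < n" using W by simp
    then have "(Q *\<^sub>v w) $ i = c * (Q *\<^sub>v a) $ i"
      using ker[OF a(1,2), of i] ker[OF w, of i] Qa by (cases i) (auto simp: c_def)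
    then show "(Q *\<^sub>v w) $ i = (c \<cdot>\<^sub>v (Q *\<^sub>v a)) $ i" using i W by simp
  qed (use W in simp)
  then have "P *\<^sub>v (Q *\<^sub>v w) = P *\<^sub>v (c \<cdot>\<^sub>v (Q *\<^sub>v a))" by simp
  also have "\<dots> = c \<cdot>\<^sub>v (P *\<^sub>v (Q *\<^sub>v a))" using W a by (simp add: mult_mat_vec[of _ n n])
  finally show ?thesis using PQ a w by auto
qed

section \<open>The spectral bound by the second eigenvalue\<close>

text \<open>The maximal Rayleigh quotient \<open>\<mu>\<close> on sum-zero vectors is a root of the
  characteristic polynomial, hence some \<open>lam j\<close>. Excluding \<open>j = 1\<close> leaves
  \<open>\<mu> \<le> lam 2\<close>.\<close>

lemma coupling_matrix_form_mean_zero: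
  fixes v :: "nat \<Rightarrow> real"
  assumes cm: "coupling_matrix N A" and oe: "ordered_eigenvalues N A lam" and "lam 1 = 0"
    and v: "(\<Sum>i<N. v i) = 0" and "N \<ge> 2"
  shows "(\<Sum>i<N. v i * (\<Sum>j<N. A $$ (i, j) * v j)) \<le> lam 2 * (\<Sum>i<N. (v i)\<^sup>2)"
\<comment> \<open>If \<open>lam 2 = 0\<close>, the eigenvalue 0 is not simple, but semidefiniteness
  alone gives the bound.\<close>
proof (cases "lam 2 = 0")
  case True
  then show ?thesis using coupling_matrix_form_nonpos[OF cm, of v] by simp
next
  case False
  then have neg: "lam 2 < 0" using ordered_eigenvalues_nonpos[OF oe \<open>lam 1 = 0\<close> \<open>N \<ge> 2\<close>] by simp
  have A: "A \<in> carrier_mat N N"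
    and rs: "\<And>i. i < N \<Longrightarrow> (\<Sum>j<N. A $$ (i, j)) = 0"
    using cm by (auto simp: coupling_matrix_def)
  note sym = coupling_matrix_sym[OF cm]
  have cp: "char_poly A = (\<Prod>j\<in>{1..N}. [:- lam j, 1:])" and mono: "antimono_on {1..N} lam"
    using oe by (auto simp: ordered_eigenvalues_def)
  have le2: "lam j \<le> lam 2" if "2 \<le> j" "j \<le> N" for j
    using monotone_onD[OF mono, of 2 j] that by simp
  obtain \<mu> w where w: "(\<Sum>i<N. w i) = 0" "(\<Sum>i<N. (w i)\<^sup>2) = 1"
    "\<forall>i<N. (\<Sum>j<N. A $$ (i, j) * w j) = \<mu> * w i"
    and bound: "\<forall>v. (\<Sum>i<N. v i) = 0 \<longrightarrow>
      (\<Sum>i<N. v i * (\<Sum>j<N. A $$ (i, j) * v j)) \<le> \<mu> * (\<Sum>i<N. (v i)\<^sup>2)"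
    by (rule rayleigh_eigenvector[OF sym rs \<open>N \<ge> 2\<close>]) (assumption | rule that)+
  define W where "W = Matrix.vec N w"
  have Aw: "A *\<^sub>v W = \<mu> \<cdot>\<^sub>v W"
    using A w(3) by (intro eq_vecI) (auto simp: W_def scalar_prod_def lessThan_atLeast0)
  have W0: "W \<noteq> 0\<^sub>v N"
  proof
    assume "W = 0\<^sub>v N"
    then have "w i = 0" if "i < N" for i using that unfolding W_def by (metis index_vec index_zero_vec(1))
    then show False using w(2) by simp
  qed
  have "eigenvector A W \<mu>" using A Aw W0 by (simp add: eigenvector_def W_def)
  then have "poly (char_poly A) \<mu> = 0"
    using eigenvalue_root_char_poly[OF A] by (auto simp: eigenvalue_def)
  then obtain j where j: "1 \<le> j" "j \<le> N" "\<mu> = lam j"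
    by (auto simp: cp poly_prod)
  \<comment> \<open>otherwise \<open>w\<close> and the constant vector span a two-dimensional kernel, while \<open>lam 2 < 0\<close>
    makes \<open>0\<close> a simple eigenvalue\<close>
  have "\<mu> \<noteq> 0"
  proof
    assume "\<mu> = 0"
    define es where "es = map lam [2..<Suc N]"
    have "char_poly A = (\<Prod>j\<in>set (1 # [2..<Suc N]). [:- lam j, 1:])"
      unfolding cp using \<open>N \<ge> 2\<close> by (intro prod.cong) auto
    also have "\<dots> = (\<Prod>j\<leftarrow>1 # [2..<Suc N]. [:- lam j, 1:])"
      by (rule prod.distinct_set_conv_list) simp
    also have "\<dots> = (\<Prod>e\<leftarrow>0 # es. [:- e, 1:])"
      using \<open>lam 1 = 0\<close> by (simp add: es_def o_def del: upt_Suc)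
    finally have "char_poly A = (\<Prod>e\<leftarrow>0 # es. [:- e, 1:])" .
    moreover have "0 \<notin> set es"
      using le2 neg by (fastforce simp: es_def)
    moreover have "A *\<^sub>v Matrix.vec N (\<lambda>_. 1) = 0\<^sub>v N"
      using A rs by (intro eq_vecI) (auto simp: scalar_prod_def lessThan_atLeast0)
    moreover have "Matrix.vec N (\<lambda>_. 1::real) \<noteq> 0\<^sub>v N"
    proof
      assume "Matrix.vec N (\<lambda>_. 1::real) = 0\<^sub>v N"
      then have "Matrix.vec N (\<lambda>_. 1::real) $ 0 = 0\<^sub>v N $ 0" by simp
      then show False using \<open>N \<ge> 2\<close> by simp
    qed
    moreover have "A *\<^sub>v W = 0\<^sub>v N" using Aw \<open>\<mu> = 0\<close> by (auto simp: W_def)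
    ultimately obtain c where c: "W = c \<cdot>\<^sub>v Matrix.vec N (\<lambda>_. 1)"
      using kernel_unique_of_simple_zero[OF A, of es "Matrix.vec N (\<lambda>_. 1)" W] by (auto simp: W_def)
    have wc: "w i = c" if "i < N" for i
      using arg_cong[OF c, of "\<lambda>u. u $ i"] that by (simp add: W_def)
    then have "real N * c = 0" using w(1) by simp
    then show False using wc w(2) \<open>N \<ge> 2\<close> by simp
  qed
  then have "j \<noteq> 1" using j \<open>lam 1 = 0\<close> by auto
  then have "\<mu> \<le> lam 2" using le2 j by auto
  then have "\<mu> * (\<Sum>i<N. (v i)\<^sup>2) \<le> lam 2 * (\<Sum>i<N. (v i)\<^sup>2)"
    by (intro mult_right_mono sum_nonneg) auto
  then show ?thesis using bound[rule_format, OF v] by linarith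
qed

text \<open>The form splits over an orthonormal basis into scalar forms, one for each
  coordinate.\<close>

lemma coupling_matrix_vector_form_mean_zero:
  fixes y :: "nat \<Rightarrow> 'v::euclidean_space"
  assumes "coupling_matrix N A" "ordered_eigenvalues N A lam" "lam 1 = 0"
    and y: "(\<Sum>i<N. y i) = 0" and "N \<ge> 2"
  shows "(\<Sum>p<N. inner (y p) (\<Sum>j<N. A $$ (p, j) *\<^sub>R y j)) \<le> lam 2 * (\<Sum>p<N. inner (y p) (y p))"
proof -
  have "(\<Sum>p<N. inner (y p) (\<Sum>j<N. A $$ (p, j) *\<^sub>R y j))
      = (\<Sum>b\<in>Basis. \<Sum>p<N. inner (y p) b * (\<Sum>j<N. A $$ (p, j) * inner (y j) b))"
    by (subst euclidean_inner, subst sum.swap) (simp add: inner_sum_left)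
  also have "\<dots> \<le> (\<Sum>b\<in>Basis. lam 2 * (\<Sum>p<N. (inner (y p) b)\<^sup>2))"
  proof (rule sum_mono, rule coupling_matrix_form_mean_zero[OF assms(1-3) _ \<open>N \<ge> 2\<close>])
    show "(\<Sum>i<N. inner (y i) b) = 0" for b using y by (simp flip: inner_sum_left)
  qed
  also have "\<dots> = lam 2 * (\<Sum>p<N. inner (y p) (y p))"
    unfolding sum_distrib_left[symmetric]
    by (subst (2) euclidean_inner, subst sum.swap) (simp add: power2_eq_square)
  finally show ?thesis .
qed

section \<open>Sums over nodes, fibre means and deviations\<close>

lemma finite_nodes: "finite (nodes m I)"
  unfolding nodes_def by (intro finite_PiE) auto

lemma nodes_upd: "i \<in> nodes m I \<Longrightarrow> s \<in> {1..m} \<Longrightarrow> p < I s \<Longrightarrow> i(s := p) \<in> nodes m I"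
  by (auto simp: nodes_def PiE_iff extensional_def)

lemma nodes_lt: "i \<in> nodes m I \<Longrightarrow> s \<in> {1..m} \<Longrightarrow> i s < I s"
  by (auto simp: nodes_def PiE_iff)

text \<open>Letting every node stand for its whole \<open>s\<close>-fibre counts each node
  \<open>I s\<close> times. This localizes a node sum to fibres without choosing fibre
  representatives.\<close>

lemma sum_nodes_fibre:
  fixes g :: "(nat \<Rightarrow> nat) \<Rightarrow> real"
  assumes s: "s \<in> {1..m}"
  shows "(\<Sum>i\<in>nodes m I. \<Sum>p<I s. g (i(s := p))) = real (I s) * (\<Sum>i\<in>nodes m I. g i)"
proof -
  have "(\<Sum>i\<in>nodes m I. \<Sum>p<I s. g (i(s := p))) = (\<Sum>(i, p)\<in>nodes m I \<times> {..<I s}. g (i(s := p)))"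
    by (simp add: sum.cartesian_product)
  also have "\<dots> = (\<Sum>(i, p)\<in>nodes m I \<times> {..<I s}. g i)"
    \<comment> \<open>Exchanging the \<open>s\<close>-th index with \<open>p\<close> is an
      involution, so it serves as its own inverse.\<close>
    by (rule sum.reindex_bij_witness[where i = "\<lambda>(i, p). (i(s := p), i s)"
          and j = "\<lambda>(i, p). (i(s := p), i s)"]) (use s in \<open>auto simp: nodes_upd nodes_lt\<close>)
  also have "\<dots> = real (I s) * (\<Sum>i\<in>nodes m I. g i)"
    by (simp add: sum.cartesian_product[symmetric] sum_distrib_left)
  finally show ?thesis .
qed

definition fibre_mean :: "nat \<Rightarrow> nat \<Rightarrow> ((nat \<Rightarrow> nat) \<Rightarrow> 'v::real_vector) \<Rightarrow> (nat \<Rightarrow> nat) \<Rightarrow> 'v" where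
  "fibre_mean N k x i = (\<Sum>p<N. x (i(k := p))) /\<^sub>R real N"

definition fibre_deviation :: "nat \<Rightarrow> nat \<Rightarrow> ((nat \<Rightarrow> nat) \<Rightarrow> 'v::real_vector) \<Rightarrow> (nat \<Rightarrow> nat) \<Rightarrow> 'v" where
  "fibre_deviation N k x i = x i - fibre_mean N k x i"

lemma fibre_mean_upd [simp]: "fibre_mean N k x (i(k := p)) = fibre_mean N k x i"
  by (simp add: fibre_mean_def)

lemma sum_fibre_deviation: "(\<Sum>p<N. fibre_deviation N k x (i(k := p))) = 0"
  by (cases "N = 0") (simp_all add: fibre_deviation_def sum_subtractf sum_constant_scaleR fibre_mean_def)

text \<open>On each \<open>k\<close>-fibre \<open>G\<close> is constant and the deviations add up to
  zero.\<close>

lemma sum_fibre_deviation_orthogonal: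
  fixes x G :: "(nat \<Rightarrow> nat) \<Rightarrow> 'v::real_inner"
  assumes k: "k \<in> {1..m}" and "I k \<noteq> 0"
    and G: "\<And>i p. G (i(k := p)) = G i"
  shows "(\<Sum>i\<in>nodes m I. inner (fibre_deviation (I k) k x i) (G i)) = 0"
proof -
  have "real (I k) * (\<Sum>i\<in>nodes m I. inner (fibre_deviation (I k) k x i) (G i)) = 0"
    unfolding sum_nodes_fibre[OF k, symmetric]
    by (simp add: G inner_sum_left[symmetric] sum_fibre_deviation)
  then show ?thesis using \<open>I k \<noteq> 0\<close> by simp
qed

section \<open>Coupling terms summed over all nodes\<close>

definition coupling_term :: "nat \<Rightarrow> real mat \<Rightarrow> nat \<Rightarrow> ((nat \<Rightarrow> nat) \<Rightarrow> 'v::real_vector) \<Rightarrow> (nat \<Rightarrow> nat) \<Rightarrow> 'v" where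
  "coupling_term N A s y i = (\<Sum>j<N. A $$ (i s, j) *\<^sub>R y (i(s := j)))"

text \<open>By linearity only the coupling of the fibre mean must drop out. For \<open>s = k\<close>
  it is zero by the row sums; for \<open>s \<noteq> k\<close> it is still constant along
  \<open>k\<close>-fibres, hence orthogonal to \<open>e\<close>.\<close>

lemma sum_coupling_term_deviation:
  fixes x :: "(nat \<Rightarrow> nat) \<Rightarrow> 'v::real_inner"
  assumes k: "k \<in> {1..m}" and "I k \<noteq> 0" and cm: "coupling_matrix (I k) (L k)"
  defines "e \<equiv> fibre_deviation (I k) k x"
  shows "(\<Sum>i\<in>nodes m I. inner (e i) (coupling_term (I s) (L s) s x i))
       = (\<Sum>i\<in>nodes m I. inner (e i) (coupling_term (I s) (L s) s e i))"
proof -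
  let ?M = "fibre_mean (I k) k x"
  have "coupling_term (I s) (L s) s x i = coupling_term (I s) (L s) s e i + coupling_term (I s) (L s) s ?M i" for i
    by (simp add: coupling_term_def e_def fibre_deviation_def algebra_simps flip: sum.distrib)
  moreover have "(\<Sum>i\<in>nodes m I. inner (e i) (coupling_term (I s) (L s) s ?M i)) = 0"
  proof (cases "s = k")
    case True
    have "coupling_term (I s) (L s) s ?M i = 0" if "i \<in> nodes m I" for i
      using cm nodes_lt[OF that k] True
      by (simp add: coupling_term_def coupling_matrix_def flip: scaleR_sum_left)
    then show ?thesis by simp
  next
    case False
    then show ?thesis unfolding e_def
      by (intro sum_fibre_deviation_orthogonal[where I = I and k = k] k \<open>I k \<noteq> 0\<close>)
        (simp add: coupling_term_def fun_upd_twist[of k s])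
  qed
  ultimately show ?thesis by (simp add: inner_add_right sum.distrib)
qed

lemma sum_coupling_term_nonpos:
  fixes y :: "(nat \<Rightarrow> nat) \<Rightarrow> 'v::real_inner"
  assumes s: "s \<in> {1..m}" and "I s \<noteq> 0" and cm: "coupling_matrix (I s) A"
  shows "(\<Sum>i\<in>nodes m I. inner (y i) (coupling_term (I s) A s y i)) \<le> 0"
proof -
  have "real (I s) * (\<Sum>i\<in>nodes m I. inner (y i) (coupling_term (I s) A s y i)) \<le> 0"
    unfolding sum_nodes_fibre[OF s, symmetric] coupling_term_def
    by (rule sum_nonpos) (simp, rule coupling_matrix_form_nonpos[OF cm])
  then show ?thesis using \<open>I s \<noteq> 0\<close> by (simp add: mult_le_0_iff)
qed

text \<open>The deviation sums to zero on each \<open>k\<close>-fibre, so the spectral bound applies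
  fibre by fibre, and the multiplicity \<open>I k\<close> cancels.\<close>

lemma sum_coupling_term_spectral:
  fixes x :: "(nat \<Rightarrow> nat) \<Rightarrow> 'v::euclidean_space"
  assumes k: "k \<in> {1..m}" and "I k \<ge> 2" and "coupling_matrix (I k) A"
    and "ordered_eigenvalues (I k) A lam" "lam 1 = 0"
  defines "e \<equiv> fibre_deviation (I k) k x"
  shows "(\<Sum>i\<in>nodes m I. inner (e i) (coupling_term (I k) A k e i)) \<le> lam 2 * (\<Sum>i\<in>nodes m I. inner (e i) (e i))"
proof -
  have "real (I k) * (\<Sum>i\<in>nodes m I. inner (e i) (coupling_term (I k) A k e i))
      = (\<Sum>i\<in>nodes m I. \<Sum>p<I k. inner (e (i(k := p))) (\<Sum>j<I k. A $$ (p, j) *\<^sub>R e (i(k := j))))"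
    unfolding sum_nodes_fibre[OF k, symmetric] coupling_term_def by simp
  also have "\<dots> \<le> (\<Sum>i\<in>nodes m I. lam 2 * (\<Sum>p<I k. inner (e (i(k := p))) (e (i(k := p)))))"
    by (intro sum_mono coupling_matrix_vector_form_mean_zero assms(3-5) \<open>I k \<ge> 2\<close>)
      (simp add: e_def sum_fibre_deviation)
  also have "\<dots> = real (I k) * (lam 2 * (\<Sum>i\<in>nodes m I. inner (e i) (e i)))"
    using sum_nodes_fibre[OF k, where g = "\<lambda>i. inner (e i) (e i)" and I = I]
    by (simp flip: sum_distrib_left)
  finally show ?thesis using \<open>I k \<ge> 2\<close> by (simp add: mult_le_cancel_left)
qed

text \<open>The left side is half the derivative of the sum of the \<open>|e i|^2\<close> along a
  solution.\<close>

lemma dissipation: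
  fixes f :: "'v::euclidean_space \<Rightarrow> 'v" and x :: "(nat \<Rightarrow> nat) \<Rightarrow> 'v"
  assumes f: "\<And>x y. inner (x - y) (f x - f y) \<le> \<alpha> * inner (x - y) (x - y)"
    and I: "\<And>s. s \<in> {1..m} \<Longrightarrow> I s \<ge> 1"
    and c: "\<And>s. s \<in> {1..m} \<Longrightarrow> c s \<ge> 0"
    and cm: "\<And>s. s \<in> {1..m} \<Longrightarrow> coupling_matrix (I s) (L s)"
    and oe: "ordered_eigenvalues (I k) (L k) lam" "lam 1 = 0"
    and k: "k \<in> {1..m}" "I k \<ge> 2"
  defines "e \<equiv> fibre_deviation (I k) k x"
  shows "(\<Sum>i\<in>nodes m I. inner (e i) (f (x i) + (\<Sum>s=1..m. c s *\<^sub>R coupling_term (I s) (L s) s x i)))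
    \<le> (c k * lam 2 + \<alpha>) * (\<Sum>i\<in>nodes m I. inner (e i) (e i))"
proof -
  define V where "V = (\<Sum>i\<in>nodes m I. inner (e i) (e i))"
  define S where "S s = (\<Sum>i\<in>nodes m I. inner (e i) (coupling_term (I s) (L s) s e i))" for s
  have Ik: "I k \<noteq> 0" using k by simp
  let ?M = "fibre_mean (I k) k x"
  \<comment> \<open>Subtracting \<open>f (?M i)\<close>, which is constant along
    \<open>k\<close>-fibres, changes nothing and makes the one-sided Lipschitz bound applicable,
    since \<open>x i - ?M i = e i\<close>.\<close>
  have "(\<Sum>i\<in>nodes m I. inner (e i) (f (x i)))
      = (\<Sum>i\<in>nodes m I. inner (e i) (f (x i) - f (?M i)))"
    using sum_fibre_deviation_orthogonal[where G = "\<lambda>i. f (?M i)" and I = I and k = k, OF k(1) Ik, of x]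
    by (simp add: e_def inner_diff_right sum_subtractf)
  also have "\<dots> \<le> (\<Sum>i\<in>nodes m I. \<alpha> * inner (e i) (e i))"
    unfolding e_def fibre_deviation_def by (intro sum_mono f)
  finally have 1: "(\<Sum>i\<in>nodes m I. inner (e i) (f (x i))) \<le> \<alpha> * V"
    by (simp add: V_def sum_distrib_left)
  have "(\<Sum>i\<in>nodes m I. inner (e i) (\<Sum>s=1..m. c s *\<^sub>R coupling_term (I s) (L s) s x i))
      = (\<Sum>s=1..m. c s * (\<Sum>i\<in>nodes m I. inner (e i) (coupling_term (I s) (L s) s x i)))"
    by (simp add: inner_sum_right sum_distrib_left) (rule sum.swap)
  also have "\<dots> = (\<Sum>s=1..m. c s * S s)"
    unfolding S_def e_def 
    by (simp only: sum_coupling_term_deviation[where I = I and k = k and L = L, OF k(1) Ik cm[OF k(1)]])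
  also have "\<dots> = c k * S k + (\<Sum>s\<in>{1..m} - {k}. c s * S s)"
    using k by (intro sum.remove) auto
  \<comment> \<open>Nonnegative coupling strengths let the other orders be discarded; the same sign
    condition for \<open>c k\<close> carries the spectral bound through the multiplication
    below.\<close>
  also have "(\<Sum>s\<in>{1..m} - {k}. c s * S s) \<le> 0"
  proof (rule sum_nonpos)
    fix s assume "s \<in> {1..m} - {k}"
    then have s: "s \<in> {1..m}" by simp
    have "S s \<le> 0" unfolding S_def using I[OF s] by (intro sum_coupling_term_nonpos s cm) simp
    then show "c s * S s \<le> 0" using c[OF s] by (simp add: mult_nonneg_nonpos)
  qed
  also have "c k * S k \<le> c k * (lam 2 * V)"
    unfolding S_def V_def e_def
    by (intro mult_left_mono sum_coupling_term_spectral k cm oe c)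
  finally have 2: "(\<Sum>i\<in>nodes m I. inner (e i) (\<Sum>s=1..m. c s *\<^sub>R coupling_term (I s) (L s) s x i))
      \<le> c k * lam 2 * V" by simp
  show ?thesis
    unfolding V_def[symmetric] inner_add_right sum.distrib distrib_right using 1 2 by linarith
qed

section \<open>Exponential decay\<close>

text \<open>Gronwall's argument: with the integrating factor \<open>exp (- r * t)\<close> the
  function becomes nonincreasing.\<close>

lemma exponential_decay:
  fixes V :: "real \<Rightarrow> real"
  assumes der: "\<And>t. t \<ge> 0 \<Longrightarrow> (V has_real_derivative V' t) (at t within {0..})"
    and le: "\<And>t. t \<ge> 0 \<Longrightarrow> V' t \<le> r * V t" and "t \<ge> 0"
  shows "V t \<le> V 0 * exp (r * t)"
proof -
  define W where "W t = V t * exp (- r * t)" for t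
  have W: "(W has_real_derivative (V' t - r * V t) * exp (- r * t)) (at t within {0..})" if "t \<ge> 0" for t
    unfolding W_def by (rule derivative_eq_intros der that refl | simp add: algebra_simps)+
  have "W t \<le> W 0"
  proof (rule DERIV_nonpos_imp_decreasing_open[OF \<open>t \<ge> 0\<close>])
    fix u assume u: "0 < u" "u < t"
    \<comment> \<open>At interior points the derivative within the half-line is two-sided; the
      endpoint 0 needs only continuity.\<close>
    then have "at u within {0..} = at u" by (intro at_within_interior) (simp add: interior_Ici[of "-1"])
    then show "\<exists>y. DERIV W u :> y \<and> y \<le> 0"
      using W[of u] le[of u] u by (auto intro!: exI[of _ "(V' u - r * V u) * exp (- r * u)"] mult_nonpos_nonneg)
  next
    have "continuous_on {0..} W"
      using W by (auto simp: continuous_on_eq_continuous_within intro: DERIV_continuous)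
    then show "continuous_on {0..t} W" by (rule continuous_on_subset) auto
  qed
  then show ?thesis by (simp add: W_def exp_minus field_simps)
qed

lemma tendsto_zero_of_exponential_bound:
  fixes g :: "real \<Rightarrow> 'v::real_inner"
  assumes "\<And>t. t \<ge> 0 \<Longrightarrow> inner (g t) (g t) \<le> C * exp (r * t)" and "r < 0"
  shows "(g \<longlongrightarrow> 0) at_top"
proof -
  have "((\<lambda>t. C * exp (r * t)) \<longlongrightarrow> C * 0) at_top"
    using \<open>r < 0\<close> by (intro tendsto_mult tendsto_const filterlim_compose[OF exp_at_bot]
      filterlim_tendsto_neg_mult_at_bot[OF tendsto_const] filterlim_ident)
  then have lim: "((\<lambda>t. C * exp (r * t)) \<longlongrightarrow> 0) at_top" by simp
  have "((\<lambda>t. (norm (g t))\<^sup>2) \<longlongrightarrow> 0) at_top"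
  proof (rule tendsto_sandwich[OF _ _ tendsto_const lim])
    show "\<forall>\<^sub>F t in at_top. (norm (g t))\<^sup>2 \<le> C * exp (r * t)"
      using eventually_ge_at_top[of 0] by eventually_elim (simp add: power2_norm_eq_inner assms(1))
  qed simp
  then have "((\<lambda>t. sqrt ((norm (g t))\<^sup>2)) \<longlongrightarrow> sqrt 0) at_top" by (rule tendsto_real_sqrt)
  then show ?thesis by (simp add: tendsto_norm_zero_iff)
qed

section \<open>Synchronization of the network\<close>

theorem theorem1:
  fixes m :: nat and I :: "nat \<Rightarrow> nat"
    and f :: "real^'n \<Rightarrow> real^'n" and \<alpha> :: real
    and c :: "nat \<Rightarrow> real" and L :: "nat \<Rightarrow> real mat" and lam :: "nat \<Rightarrow> nat \<Rightarrow> real"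
    and k :: nat
  assumes "m \<ge> 1"
    and "\<And>s. s \<in> {1..m} \<Longrightarrow> I s \<ge> 1"
    and "continuous_on UNIV f"
    and "\<And>x y. inner (x - y) (f x - f y) \<le> \<alpha> * inner (x - y) (x - y)"
    and "\<And>s. s \<in> {1..m} \<Longrightarrow> c s \<ge> 0"
    and "\<And>s. s \<in> {1..m} \<Longrightarrow> coupling_matrix (I s) (L s)"
    and "\<And>s. s \<in> {1..m} \<Longrightarrow> ordered_eigenvalues (I s) (L s) (lam s)"
    and "\<And>s. s \<in> {1..m} \<Longrightarrow> lam s 1 = 0"
    and "k \<in> {1..m}"
    and "c k * lam k 2 + \<alpha> < 0"
  shows "network_reaches_synchronization m I f c L k"
  unfolding network_reaches_synchronization_def
proof (intro allI impI)
  fix x :: "(nat \<Rightarrow> nat) \<Rightarrow> real \<Rightarrow> real^'n"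
  assume sol: "network_solution m I f c L x"
  show "synchronized_of_order m I k x"
  proof (cases "I k \<ge> 2")
    \<comment> \<open>A fibre with a single node has no second eigenvalue and nothing to
      synchronize: \<open>p = q\<close>.\<close>
    case False
    then have same: "p = q" if "p < I k" "q < I k" for p q using that by linarith
    show ?thesis unfolding synchronized_of_order_def
    proof (intro allI impI ballI)
      fix p q i assume "p < I k" "q < I k"
      then have "p = q" using same by blast
      then show "((\<lambda>t. norm (x (i(k := p)) t - x (i(k := q)) t)) \<longlongrightarrow> 0) at_top" by simp
    qed
  next
    case True
    have k: "k \<in> {1..m}" "I k \<noteq> 0" using assms(9) True by auto
    \<comment> \<open>With time as first argument, \<open>X t\<close> is a configuration of all
      nodes, to which the fibre operations apply; \<open>F t\<close> is its velocity.\<close>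
    define X where "X t i = x i t" for t i
    define F where "F t i = f (X t i) + (\<Sum>s=1..m. c s *\<^sub>R coupling_term (I s) (L s) s (X t) i)" for t i
    define e where "e t = fibre_deviation (I k) k (X t)" for t
    define V where "V t = (\<Sum>i\<in>nodes m I. inner (e t i) (e t i))" for t
    define V' where "V' t = (\<Sum>i\<in>nodes m I. 2 * inner (e t i) (fibre_deviation (I k) k (F t) i))" for t
    let ?r = "2 * (c k * lam k 2 + \<alpha>)"
    have x': "((\<lambda>t. X t i) has_vector_derivative F t i) (at t within {0..})"
      if "i \<in> nodes m I" "t \<ge> 0" for i t
      using sol that by (simp add: network_solution_def X_def F_def coupling_term_def)
    have e': "((\<lambda>t. e t i) has_vector_derivative fibre_deviation (I k) k (F t) i) (at t within {0..})"
      if "i \<in> nodes m I" "t \<ge> 0" for i t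
      unfolding e_def fibre_deviation_def fibre_mean_def using that k
      by (intro has_vector_derivative_diff has_vector_derivative_sum x' nodes_upd
          bounded_linear.has_vector_derivative[OF bounded_linear_scaleR_right]) auto
    have "(V has_real_derivative V' t) (at t within {0..})" if "t \<ge> 0" for t
    proof -
      have "((\<lambda>t. inner (e t i) (e t i)) has_vector_derivative
          2 * inner (e t i) (fibre_deviation (I k) k (F t) i)) (at t within {0..})"
        if "i \<in> nodes m I" for i
        using bounded_bilinear.has_vector_derivative[OF bounded_bilinear_inner
            e'[OF that \<open>t \<ge> 0\<close>] e'[OF that \<open>t \<ge> 0\<close>]]
        by (simp add: inner_commute)
      then show ?thesis unfolding V_def V'_def has_real_derivative_iff_has_vector_derivative
        by (intro has_vector_derivative_sum)
    qed
    moreover have "V' t \<le> ?r * V t" for t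
    proof -
      \<comment> \<open>The fibre mean of \<open>F t\<close> is orthogonal to \<open>e t\<close>, so
        the deviation of \<open>F t\<close> may be replaced by \<open>F t\<close> itself.\<close>
      have "V' t = 2 * (\<Sum>i\<in>nodes m I. inner (e t i) (F t i))"
        using sum_fibre_deviation_orthogonal[where G = "fibre_mean (I k) k (F t)" and I = I and k = k,
            OF k, of "X t"]
        by (simp add: V'_def e_def fibre_deviation_def[of _ _ "F t"] inner_diff_right sum_subtractf
            flip: sum_distrib_left)
      moreover have "(\<Sum>i\<in>nodes m I. inner (e t i) (F t i)) \<le> (c k * lam k 2 + \<alpha>) * V t"
        unfolding F_def e_def V_def using assms True by (intro dissipation) auto
      ultimately show ?thesis unfolding mult.assoc by linarith
    qed
    ultimately have decay: "V t \<le> V 0 * exp (?r * t)" if "t \<ge> 0" for t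
      using exponential_decay[of V V' ?r t] that by blast
    have lim: "((\<lambda>t. e t i) \<longlongrightarrow> 0) at_top" if "i \<in> nodes m I" for i
    proof (rule tendsto_zero_of_exponential_bound)
      fix t :: real assume "t \<ge> 0"
      have "inner (e t i) (e t i) \<le> V t"
        unfolding V_def using that by (intro member_le_sum) (auto simp: finite_nodes)
      then show "inner (e t i) (e t i) \<le> V 0 * exp (?r * t)" using decay[OF \<open>t \<ge> 0\<close>] by linarith
    qed (use assms(10) in simp)
    show ?thesis unfolding synchronized_of_order_def
    proof (intro allI impI ballI)
      fix p q i assume "p < I k" "q < I k" "i \<in> nodes m I"
      then have "((\<lambda>t. norm (e t (i(k := p)) - e t (i(k := q)))) \<longlongrightarrow> norm (0 - 0 :: real^'n)) at_top"
        using k by (intro tendsto_intros lim nodes_upd)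
      \<comment> \<open>Both nodes lie on one \<open>k\<close>-fibre, so their common mean cancels
        from the difference.\<close>
      then show "((\<lambda>t. norm (x (i(k := p)) t - x (i(k := q)) t)) \<longlongrightarrow> 0) at_top"
        by (simp add: e_def fibre_deviation_def X_def)
    qed
  qed
qed

end
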